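(* Let $n\ge 0$ be an integer. Every odd positive factor $f$ of $GF(3,n)=3^{2^n}+1$ has one of the following two forms: (i) $f=k2^{n+1}+1$ for some odd positive integer $k$ with $3\nmid k$; or (ii) $f=3m2^{n+2}+1$ for some integer $m\ge 0$ (not necessarily odd).
   Context: For an integer $z\ge 0$, $GF(3,z)=3^{2^z}+1$. *)

theory Defs
  imports "HOL-Number_Theory.Number_Theory"
begin

definition GF :: "nat \<Rightarrow> nat \<Rightarrow> nat" where
  "GF b z = b ^ (2 ^ z) + 1"

end

theory Submission
  imports Defs
begin

text \<open>
  Put \<open>q = 2 ^ (n + 1)\<close>. The residue classes satisfying (i) or (ii) are the powers of the
  class that is \<open>1 + q\<close> modulo \<open>2 * q\<close> and \<open>2\<close> modulo \<open>3\<close>; its square is trivial. These classes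
  are closed under multiplication, so only prime factors \<open>p\<close> matter. The order of \<open>3\<close> modulo
  \<open>p\<close> is \<open>q\<close>, hence \<open>p = k * q + 1\<close>, and \<open>3 ^ ((p - 1) div 2) = (3 ^ (q div 2)) ^ k = (- 1) ^ k\<close>
  modulo \<open>p\<close>. By Euler's criterion and quadratic reciprocity (\<open>4 dvd p - 1\<close>), this sign is
  \<open>1\<close> or \<open>- 1\<close> according as \<open>p\<close> is \<open>1\<close> or \<open>2\<close> modulo \<open>3\<close>.
\<close>

lemma Legendre_3:
  assumes "p mod 3 \<noteq> 0"
  shows "Legendre p 3 = (if p mod 3 = 1 then 1 else - 1)"
proof -
  have r: "p mod 3 = 1 \<or> p mod 3 = 2" using assms by presburger
  show ?thesis
  proof (cases "p mod 3 = 1")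
    case True
    then have "QuadRes 3 p"
      unfolding QuadRes_def cong_def by (intro exI[of _ 1]) simp
    with True show ?thesis by (simp add: Legendre_def cong_def)
  next
    case False
    have "\<not> QuadRes 3 p"
    proof
      assume "QuadRes 3 p"
      then obtain y where y: "y\<^sup>2 mod 3 = p mod 3" by (auto simp: QuadRes_def cong_def)
      have "y mod 3 = 0 \<or> y mod 3 = 1 \<or> y mod 3 = 2" by presburger
      moreover have "y\<^sup>2 mod 3 = (y mod 3)\<^sup>2 mod 3" by (simp add: power_mod)
      ultimately show False using y r False by auto
    qed
    with False assms show ?thesis by (simp add: Legendre_def cong_def)
  qed
qed

lemma Legendre_of_3:
  fixes p :: nat
  assumes "prime p" "p mod 4 = 1" "p \<noteq> 3"
  shows "Legendre 3 (int p) = (if p mod 3 = 1 then 1 else - 1)"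
proof -
  have "p \<noteq> 2" using assms(2) by auto
  then have "p > 2" using prime_ge_2_nat[OF assms(1)] by simp
  have "\<not> 3 dvd p" using assms primes_dvd_imp_eq[of 3 p] by auto
  then have p3: "int p mod 3 \<noteq> 0" "(int p mod 3 = 1) = (p mod 3 = 1)" by presburger+
  \<comment> \<open>This exponent being even makes the sign in the reciprocity law
    \<open>+1\<close>, so the two Legendre symbols agree.\<close>
  have "even ((p - 1) div 2)" using assms(2) by presburger
  then have "Legendre (int p) (int 3) * Legendre (int 3) (int p) = 1"
    using Quadratic_Reciprocity[of p 3] assms \<open>p > 2\<close> by simp
  then show ?thesis using Legendre_3[OF p3(1)] p3(2) by (auto split: if_splits)
qed

text \<open>Since \<open>a ^ 2 ^ n\<close> is \<open>- 1\<close> modulo \<open>p\<close>, its square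
  is \<open>1\<close>, so the order is a power of 2 dividing \<open>2 ^ (n + 1)\<close>. Were it to
  divide \<open>2 ^ n\<close>, then \<open>1\<close> and \<open>- 1\<close> would agree modulo the
  odd prime \<open>p\<close>.\<close>

lemma ord_eq_2_power:
  fixes a p n :: nat
  assumes "prime p" "odd p" "p dvd a ^ 2 ^ n + 1"
  shows "ord p a = 2 ^ (n + 1)"
proof -
  have m1: "[int a ^ 2 ^ n = - 1] (mod int p)"
    using assms(3) by (metis cong_iff_dvd_diff diff_minus_eq_add int_dvd_int_iff of_nat_1
        of_nat_add of_nat_power)
  then have "[(int a ^ 2 ^ n)\<^sup>2 = (- 1)\<^sup>2] (mod int p)" by (rule cong_pow)
  then have "[int (a ^ 2 ^ (n + 1)) = int 1] (mod int p)"
    by (simp add: mult.commute flip: power_mult)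
  then have "ord p a dvd 2 ^ (n + 1)" by (simp only: cong_int_iff ord_divides)
  then obtain i where i: "i \<le> n + 1" "ord p a = 2 ^ i"
    using divides_primepow_nat[of 2] two_is_prime_nat by blast
  have "\<not> i \<le> n"
  proof
    assume "i \<le> n"
    then have "[a ^ 2 ^ n = 1] (mod p)" using i by (simp only: ord_divides le_imp_power_dvd)
    then have "[int a ^ 2 ^ n = 1] (mod int p)" by (metis cong_int_iff of_nat_1 of_nat_power)
    with m1 have "[(1::int) = - 1] (mod int p)" by (meson cong_sym cong_trans)
    then have "int p dvd int 2" by (simp add: cong_iff_dvd_diff)
    then have "p dvd 2" by (simp only: int_dvd_int_iff)
    then show False using assms(1,2) by (metis primes_dvd_imp_eq two_is_prime_nat dvd_refl)
  qed
  with i show ?thesis by (simp add: le_Suc_eq)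
qed

text \<open>For even \<open>q\<close>, the modulus \<open>2 * q\<close> divides
  \<open>q * q\<close>, so only the constant and linear terms of the binomial expansion
  survive.\<close>

lemma one_plus_power_cong:
  fixes q j :: nat
  assumes "even q"
  shows "[(1 + q) ^ j = 1 + j * q] (mod 2 * q)"
proof (induction j)
  case (Suc j)
  then have "[(1 + q) * (1 + q) ^ j = (1 + q) * (1 + j * q)] (mod 2 * q)"
    by (rule cong_scalar_left)
  moreover obtain r where "q = 2 * r" using assms by blast
  then have "(1 + q) * (1 + j * q) = 1 + Suc j * q + j * r * (2 * q)"
    by (simp add: algebra_simps)
  then have "[(1 + q) * (1 + j * q) = 1 + Suc j * q] (mod 2 * q)"
    by (simp only: cong_def mod_mult_self1)
  ultimately show ?case by (auto intro: cong_trans)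
qed simp

lemma power_2_mod_3: "2 ^ j mod (3::nat) = (if even j then 1 else 2)"
  by (induction j) (simp, simp, presburger)

lemma prime_factor_GF_3:
  assumes p: "prime p" "odd p" "p dvd GF 3 n"
  shows "\<exists>j. [p = (1 + 2 ^ (n + 1)) ^ j] (mod 2 ^ (n + 2)) \<and> [p = 2 ^ j] (mod 3)"
proof -
  have dvd: "p dvd 3 ^ 2 ^ n + 1" using p(3) by (simp add: GF_def)
  \<comment> \<open>For \<open>n = 0\<close> the number is 4, which has no odd prime factor.
    Positive \<open>n\<close> later gives \<open>4 dvd p - 1\<close>, as reciprocity
    requires.\<close>
  have n: "n \<noteq> 0"
  proof
    assume "n = 0"
    then have "p dvd 2 ^ 2" using dvd by simp
    then have "p dvd 2" using p(1) prime_dvd_power by blast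
    then show False using p(1,2) by (metis primes_dvd_imp_eq two_is_prime_nat dvd_refl)
  qed
  have p3: "p \<noteq> 3"
  proof
    assume "p = 3"
    then have "3 dvd (3::nat) ^ 2 ^ n + 1" using dvd by simp
    moreover have "3 dvd (3::nat) ^ 2 ^ n" by simp
    ultimately have "3 dvd (1::nat)" using dvd_add_right_iff by blast
    then show False by simp
  qed
  have "coprime 3 p" using p(1) p3 by (intro primes_coprime) auto
  then have "[3 ^ (p - 1) = 1] (mod p)"
    using fermat_theorem[of p 3] p(1) p3
    by (metis coprime_commute coprime_absorb_left not_prime_unit)
  then have "2 ^ (n + 1) dvd p - 1"
    using ord_eq_2_power[OF p(1,2) dvd] by (simp add: ord_divides')
  \<comment> \<open>This \<open>k\<close> will be the witness for \<open>j\<close>.\<close>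
  then obtain k where k: "p - 1 = 2 ^ (n + 1) * k" by blast
  have p1: "p > 1" using p(1) prime_gt_1_nat by blast
  have pk: "p = 1 + k * 2 ^ (n + 1)" using k p1 by (simp add: mult.commute)
  have "2 ^ 2 dvd (2::nat) ^ (n + 1)" using n by (intro le_imp_power_dvd) simp
  then have "4 dvd p - 1" using k by simp
  then have p4: "p mod 4 = 1" using p1 by presburger
  then have "p > 2" using p1 by (cases "p = 2") auto
  have m1: "[int 3 ^ 2 ^ n = - 1] (mod int p)"
    using dvd by (metis cong_iff_dvd_diff diff_minus_eq_add int_dvd_int_iff of_nat_1
        of_nat_add of_nat_power)
  have half: "(p - 1) div 2 = 2 ^ n * k" using k by simp
  have "[Legendre 3 (int p) = 3 ^ ((p - 1) div 2)] (mod int p)"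
    using euler_criterion[OF p(1) \<open>p > 2\<close>] .
  also have "3 ^ ((p - 1) div 2) = (int 3 ^ 2 ^ n) ^ k" by (simp only: half power_mult of_nat_numeral)
  also have "[(int 3 ^ 2 ^ n) ^ k = (- 1) ^ k] (mod int p)" using m1 by (rule cong_pow)
  finally have L: "[Legendre 3 (int p) = (- 1) ^ k] (mod int p)" .
  \<comment> \<open>The signs \<open>1\<close> and \<open>- 1\<close> stay distinct modulo
    \<open>p\<close>, so the congruence \<open>L\<close> ties the parity of \<open>k\<close> to
    \<open>p mod 3\<close>.\<close>
  have n2: "\<not> int p dvd 2" "\<not> int p dvd - 2" using \<open>p > 2\<close> zdvd_imp_le[of "int p" 2] by auto
  have "\<not> 3 dvd p" using p(1) p3 primes_dvd_imp_eq[of 3 p] by auto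
  then have "p mod 3 = 1 \<or> p mod 3 = 2" by presburger
  then have "[p = 2 ^ k] (mod 3)"
    using L Legendre_of_3[OF p(1) p4 p3] n2
    by (cases "even k") (auto simp: cong_iff_dvd_diff cong_def[of p] power_2_mod_3 split: if_splits)
  moreover have "[p = (1 + 2 ^ (n + 1)) ^ k] (mod 2 ^ (n + 2))"
    using one_plus_power_cong[of "2 ^ (n + 1)" k] by (simp add: pk cong_sym_eq)
  ultimately show ?thesis by blast
qed

text \<open>Sharing one \<open>j\<close> between both congruences makes the property multiplicative:
  splitting off a prime, the exponents of the two factors add.\<close>

lemma odd_factor_GF_3:
  assumes "odd f" "f dvd GF 3 n"
  shows "\<exists>j. [f = (1 + 2 ^ (n + 1)) ^ j] (mod 2 ^ (n + 2)) \<and> [f = 2 ^ j] (mod 3)"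
  using assms
proof (induction f rule: less_induct)
  case (less f)
  show ?case
  proof (cases "f = 1")
    case True
    then show ?thesis by (intro exI[of _ 0]) simp
  next
    case False
    then obtain p where p: "prime p" "p dvd f" using prime_factor_nat by blast
    then obtain g where g: "f = p * g" by blast
    have "g > 0" using g less.prems(1) by (cases g) auto
    then have "g < f" using g prime_gt_1_nat[OF p(1)] by simp
    have "odd g" "g dvd GF 3 n" "odd p" "p dvd GF 3 n"
      using less.prems g by (auto dest: dvd_mult_left dvd_mult_right)
    then obtain i j where
      "[p = (1 + 2 ^ (n + 1)) ^ i] (mod 2 ^ (n + 2))" "[p = 2 ^ i] (mod 3)"
      "[g = (1 + 2 ^ (n + 1)) ^ j] (mod 2 ^ (n + 2))" "[g = 2 ^ j] (mod 3)"
      using prime_factor_GF_3[OF p(1)] less.IH[OF \<open>g < f\<close>] by blast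
    then have "[f = (1 + 2 ^ (n + 1)) ^ (i + j)] (mod 2 ^ (n + 2))" "[f = 2 ^ (i + j)] (mod 3)"
      unfolding g power_add[of _ i j] by (auto intro: cong_mult)
    then show ?thesis by blast
  qed
qed

theorem theorem2:
  fixes n f :: nat
  assumes "f > 0" and "odd f" and "f dvd GF 3 n"
  shows "(\<exists>k::nat. k > 0 \<and> odd k \<and> \<not> 3 dvd k \<and> f = k * 2 ^ (n + 1) + 1)
       \<or> (\<exists>m::nat. f = 3 * m * 2 ^ (n + 2) + 1)"
proof -
  obtain j where j: "[f = (1 + 2 ^ (n + 1)) ^ j] (mod 2 ^ (n + 2))" "[f = 2 ^ j] (mod 3)"
    using odd_factor_GF_3[OF assms(2,3)] by blast
  define q :: nat where "q = 2 ^ (n + 1)"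
  have q: "2 ^ (n + 2) = 2 * q" "even q" "q > 0" by (simp_all add: q_def)
  have fq: "[f = 1 + j * q] (mod 2 * q)"
    using j(1) one_plus_power_cong[OF q(2)] unfolding q(1) q_def[symmetric]
    by (rule cong_trans)
  then have "[f = 1 + j * q] (mod q)" by (rule cong_dvd_modulus_nat) simp
  then have "[f = 1] (mod q)" by (simp only: cong_def mod_mult_self1)
  then have "q dvd f - 1" using assms(1) by (simp add: cong_altdef_nat)
  then obtain k where "f - 1 = q * k" by blast
  then have k: "f = k * q + 1" using assms(1) by (simp add: mult.commute)
  have "[k * q = j * q] (mod 2 * q)" using fq unfolding k add.commute[of 1] cong_add_rcancel_nat .
  \<comment> \<open>Cancelling \<open>q\<close> from both sides and from the modulus
    \<open>2 * q\<close> leaves a statement about parity.\<close>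
  then have "[k = j] (mod 2)" using q(3) by (simp add: cong_def mod_mult_mult2)
  then have par: "even k = even j" by (metis cong_dvd_iff)
  show ?thesis
  proof (cases "even j")
    case True
    then have "[1 + k * q = 1 + 0] (mod 3)" using j(2) k by (simp add: cong_def power_2_mod_3)
    then have "3 dvd k * q" unfolding cong_add_lcancel_nat by (simp add: cong_0_iff)
    moreover have "coprime 3 q" by (simp add: q_def)
    ultimately have "3 dvd k" using coprime_dvd_mult_left_iff by blast
    moreover have "2 dvd k" using par True by simp
    \<comment> \<open>The factor 3 of \<open>k\<close> appears explicitly in form (ii), while its
      factor 2 raises the exponent from \<open>n + 1\<close> to \<open>n + 2\<close>.\<close>
    ultimately have "6 dvd k" by presburger
    then obtain m where "k = 6 * m" by blast
    then have "f = 3 * m * 2 ^ (n + 2) + 1" using k q(1) by simp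
    then show ?thesis by blast
  next
    case False
    have "\<not> 3 dvd k"
    proof
      assume "3 dvd k"
      then have "3 dvd k * q" by simp
      \<comment> \<open>For odd \<open>j\<close>, the power \<open>2 ^ j\<close> forces residue 2
        instead.\<close>
      then have "f mod 3 = 1" using k by presburger
      then show False using j(2) False by (simp add: cong_def power_2_mod_3)
    qed
    moreover have "odd k" using par False by simp
    moreover from this have "k > 0" by (cases k) auto
    ultimately show ?thesis using k q_def by blast
  qed
qed

end
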